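(* Let $X,P\in\mathbb{R}^m$ be arbitrary vectors and let $G\in\mathbb{R}^{m\times m}$ be a $\mathcal{P}$-matrix. Then: (i) The affine game $\operatorname{AG}(X,P,G)$ has at least one Nash equilibrium, and all Nash equilibria of $\operatorname{AG}(X,P,G)$ attain the same payoff vector, denoted $V^*$. (ii) The Nash equilibrium payoff $V^*$ satisfies $$\big(G^{-1}(V^*-P)\big)^{\mathsf T}(y-V^* )\geq 0\quad\text{for all } y\in\mathbb{O}(X),\qquad \mathbb{O}(X):=\{x\in\mathbb{R}^m: x\geq X\}.$$ If $G$ is a positive definite symmetric matrix, then $V^*=\pi^{G^{-1}}_{\mathbb{O}(X)}(P)$, where $\pi^{G^{-1}}_{\mathbb{O}(X)}:\mathbb{R}^m\to\mathbb{O}(X)$ is the projection onto $\mathbb{O}(X)$ under the inner product $\langle x,y\rangle^{G^{-1}}=x^{\mathsf T}G^{-1}y$. (iii) If $G$ is a $\mathcal{K}$-matrix, then the affine game $\operatorname{AG}(X,P,G)$ has the WUC (weakly unilaterally competitive) property, and the Nash equilibrium payoff $V^*$ is also the unique value of the game.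
   Context: Vectors are column vectors and inequalities between vectors are component-wise. For a real square matrix $M$: $M$ is a $\mathcal{P}$-matrix if all its principal minors are positive; a $\mathcal{Z}$-matrix if all its off-diagonal entries are non-positive; a $\mathcal{K}$-matrix if it is both a $\mathcal{P}$-matrix and a $\mathcal{Z}$-matrix. Affine game. Let $\mathcal{M}=\{1,\dots,m\}$ be the set of players, and let $G\in\mathbb{R}^{m\times m}$ have a positive diagonal and non-zero principal minors. In $\operatorname{AG}(X,P,G)$ each player $i$ chooses $s^i\in\mathcal{S}^i=\{0,1\}$ ($0$ = exercise, $1$ = not exercise). The set of (pure) strategy profiles is $\mathcal{S}=\{0,1\}^m$. For $s\in\mathcal{S}$ let $\mathcal{E}(s)=\{i\in\mathcal{M}:s^i=0\}$. The payoff vector $V(s)=(V_1(s),\dots,V_m(s))$ is $$V(s)=P+G_{\cdot\mathcal{E}(s)}\big(G_{\mathcal{E}(s)\mathcal{E}(s)}\big)^{-1}\big(X_{\mathcal{E}(s)}-P_{\mathcal{E}(s)}\big),$$ where $G_{\cdot\mathcal{E}}$ is the sub-matrix of the columns of $G$ indexed by $\mathcal{E}$, $G_{\mathcal{E}\mathcal{E}}$ is the principal sub-matrix indexed by $\mathcal{E}$, and $X_{\mathcal{E}},P_{\mathcal{E}}$ are the sub-vectors indexed by $\mathcal{E}$; if $\mathcal{E}(s)=\emptyset$ then $V(s)=P$. Write $s=(s^k,s^{-k})$ with $s^{-k}\in\mathcal{S}^{-k}$ the strategies of the players other than $k$. A profile $\sigma\in\mathcal{S}$ is a Nash equilibrium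 if $V_k(\sigma^k,\sigma^{-k})=\sup_{s^k\in\mathcal{S}^k}V_k(s^k,\sigma^{-k})$ for all $k\in\mathcal{M}$. Its payoff is $V(\sigma)$. The value of the game is the vector $V^*$ with $$V^*_k=\sup_{s^k\in\mathcal{S}^k}\inf_{s^{-k}\in\mathcal{S}^{-k}}V_k(s^k,s^{-k})=\inf_{s^{-k}\in\mathcal{S}^{-k}}\sup_{s^k\in\mathcal{S}^k}V_k(s^k,s^{-k}),\quad k\in\mathcal{M},$$ provided that the second equality holds for every $k$. The game is weakly unilaterally competitive (WUC) if for all $k,l\in\mathcal{M}$ with $k\neq l$, all $s^k,\sigma^k\in\mathcal{S}^k$ and all $s^{-k}\in\mathcal{S}^{-k}$: $V_k(s^k,s^{-k})>V_k(\sigma^k,s^{-k})$ implies $V_l(s^k,s^{-k})\leq V_l(\sigma^k,s^{-k})$, and $V_k(s^k,s^{-k})=V_k(\sigma^k,s^{-k})$ implies $V_l(s^k,s^{-k})=V_l(\sigma^k,s^{-k})$. *)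

theory Defs
  imports "HOL-Analysis.Analysis"
begin

(* The players are the elements of the finite type 'm, so m = CARD('m). A principal submatrix
   A_EE cannot be given a type of its own, so minors and inverses of A_EE are written with the
   index set E: the next two definitions are det and matrix_inv with E in place of UNIV. *)

definition principal_minor :: "real^'m^'m \<Rightarrow> 'm set \<Rightarrow> real" where
  "principal_minor A E = (\<Sum>p | p permutes E. of_int (sign p) * (\<Prod>i\<in>E. A $ i $ p i))"

(* Only the entries indexed by E x E are determined. *)
definition principal_inv :: "real^'m^'m \<Rightarrow> 'm set \<Rightarrow> real^'m^'m" where
  "principal_inv A E = (SOME B.
     (\<forall>i\<in>E. \<forall>j\<in>E. (\<Sum>k\<in>E. A $ i $ k * B $ k $ j) = (if i = j then 1 else 0)) \<and>
     (\<forall>i\<in>E. \<forall>j\<in>E. (\<Sum>k\<in>E. B $ i $ k * A $ k $ j) = (if i = j then 1 else 0)))"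

lemma principal_minor_UNIV: "principal_minor A UNIV = det A"
  by (simp add: principal_minor_def det_def)

lemma principal_inv_UNIV: "principal_inv A UNIV = matrix_inv A"
  by (simp add: principal_inv_def matrix_inv_def matrix_matrix_mult_def mat_def vec_eq_iff)

definition P_matrix :: "real^'m^'m \<Rightarrow> bool" where
  "P_matrix A \<longleftrightarrow> (\<forall>E. E \<noteq> {} \<longrightarrow> principal_minor A E > 0)"

definition Z_matrix :: "real^'m^'m \<Rightarrow> bool" where
  "Z_matrix A \<longleftrightarrow> (\<forall>i j. i \<noteq> j \<longrightarrow> A $ i $ j \<le> 0)"

definition K_matrix :: "real^'m^'m \<Rightarrow> bool" where
  "K_matrix A \<longleftrightarrow> P_matrix A \<and> Z_matrix A"

(* Exercise is the strategy 0, Not_Exercise the strategy 1. *)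
datatype strategy = Exercise | Not_Exercise

type_synonym 'm profile = "'m \<Rightarrow> strategy"

definition exercise_set :: "'m profile \<Rightarrow> 'm set" where
  "exercise_set s = {i. s i = Exercise}"

(* For an empty exercise set the sums vanish, so the payoff is P. *)
definition affine_game :: "real^'m \<Rightarrow> real^'m \<Rightarrow> real^'m^'m \<Rightarrow> 'm profile \<Rightarrow> real^'m" where
  "affine_game X P G s = (let E = exercise_set s in
     P + (\<chi> i. \<Sum>j\<in>E. G $ i $ j * (\<Sum>k\<in>E. principal_inv G E $ j $ k * (X $ k - P $ k))))"

(* Games are given by their payoff function V. The profile (a, s^{-k}) is s(k := a); a
   quantifier, infimum or supremum over s^{-k} is taken over full profiles s, whose k-th
   entry is overwritten. *)

definition nash_equilibrium :: "('m profile \<Rightarrow> real^'m) \<Rightarrow> 'm profile \<Rightarrow> bool" where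
  "nash_equilibrium V \<sigma> \<longleftrightarrow> (\<forall>k. V \<sigma> $ k = (SUP a. V (\<sigma>(k := a)) $ k))"

definition is_game_value :: "('m profile \<Rightarrow> real^'m) \<Rightarrow> real^'m \<Rightarrow> bool" where
  "is_game_value V v \<longleftrightarrow> (\<forall>k.
     v $ k = (SUP a. INF s. V (s(k := a)) $ k) \<and>
     (SUP a. INF s. V (s(k := a)) $ k) = (INF s. SUP a. V (s(k := a)) $ k))"

definition weakly_unilaterally_competitive :: "('m profile \<Rightarrow> real^'m) \<Rightarrow> bool" where
  "weakly_unilaterally_competitive V \<longleftrightarrow> (\<forall>k l a b s. k \<noteq> l \<longrightarrow>
     (V (s(k := a)) $ k > V (s(k := b)) $ k \<longrightarrow> V (s(k := a)) $ l \<le> V (s(k := b)) $ l) \<and>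
     (V (s(k := a)) $ k = V (s(k := b)) $ k \<longrightarrow> V (s(k := a)) $ l = V (s(k := b)) $ l))"

definition upper_orthant :: "real^'m \<Rightarrow> (real^'m) set" where
  "upper_orthant X = {x. \<forall>i. x $ i \<ge> X $ i}"

definition symmetric_positive_definite :: "real^'m^'m \<Rightarrow> bool" where
  "symmetric_positive_definite A \<longleftrightarrow> transpose A = A \<and> (\<forall>x. x \<noteq> 0 \<longrightarrow> x \<bullet> (A *v x) > 0)"

definition inner_wrt :: "real^'m^'m \<Rightarrow> real^'m \<Rightarrow> real^'m \<Rightarrow> real" where
  "inner_wrt A x y = x \<bullet> (A *v y)"

definition norm_wrt :: "real^'m^'m \<Rightarrow> real^'m \<Rightarrow> real" where
  "norm_wrt A x = sqrt (inner_wrt A x x)"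

(* The nearest point of K to p; it exists and is unique for symmetric positive definite A and
   nonempty closed convex K. *)
definition projection_wrt :: "real^'m^'m \<Rightarrow> (real^'m) set \<Rightarrow> real^'m \<Rightarrow> real^'m" where
  "projection_wrt A K p =
     (THE z. z \<in> K \<and> (\<forall>y\<in>K. norm_wrt A (p - z) \<le> norm_wrt A (p - y)))"

end

theory Submission
  imports Defs
begin

text \<open>
  The payoff of a profile with exercise set \<open>E\<close> is \<open>V = P + G z\<close> with \<open>z = 0\<close> off \<open>E\<close> and \<open>V = X\<close>
  on \<open>E\<close>.  A P-matrix does not reverse the sign of all components of a nonzero vector: for
  \<open>x \<noteq> 0\<close> there is an \<open>i\<close> with \<open>x\<^sub>i (G x)\<^sub>i > 0\<close>.  Applied to differences of such \<open>z\<close>, this shows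
  that Nash equilibria are exactly the solutions of the linear complementarity problem
  \<open>z \<ge> 0\<close>, \<open>V \<ge> X\<close>, \<open>z \<bullet> (V - X) = 0\<close>, whose solution is unique.  For existence, map each
  exercise set to the set of players content with their strategy there; sign non-reversal makes
  this map injective on the finite power set of the players, so it is surjective and some
  exercise set contents everybody.  For a K-matrix, sign non-reversal gives inverse positivity,
  from which the WUC property and the minimax identity follow.
\<close>

section \<open>P-matrices\<close>

definition sign_nonreversing :: "real^'m^'m \<Rightarrow> bool" where
  "sign_nonreversing A \<longleftrightarrow> (\<forall>x. x \<noteq> 0 \<longrightarrow> (\<exists>i. x $ i * (A *v x) $ i > 0))"

lemma sign_nonreversingD:
  assumes "sign_nonreversing A" "\<And>i. x $ i * (A *v x) $ i \<le> 0"
  shows "x = 0"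
  using assms unfolding sign_nonreversing_def by (meson not_le)

section \<open>Principal minors when diagonal entries grow\<close>

definition add_diagonal_entry :: "real^'m^'m \<Rightarrow> 'm \<Rightarrow> real \<Rightarrow> real^'m^'m" where
  "add_diagonal_entry A k t = (\<chi> i j. A $ i $ j + (if i = k \<and> j = k then t else 0))"

lemma principal_minor_empty [simp]: "principal_minor A {} = 1"
  by (simp add: principal_minor_def)

lemma principal_minor_add_diagonal_entry_notin:
  assumes "k \<notin> E"
  shows "principal_minor (add_diagonal_entry A k t) E = principal_minor A E"
  using assms unfolding principal_minor_def add_diagonal_entry_def
  by (intro sum.cong arg_cong2[of _ _ _ _ times] prod.cong refl) auto

text \<open>A principal minor is affine in one diagonal entry: only permutations fixing
  \<open>k\<close> meet that entry, and these are the permutations of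
  \<open>E - {k}\<close>.\<close>

lemma principal_minor_add_diagonal_entry:
  fixes A :: "real^'m^'m"
  assumes "k \<in> E"
  shows "principal_minor (add_diagonal_entry A k t) E
    = principal_minor A E + t * principal_minor A (E - {k})"
proof -
  let ?B = "add_diagonal_entry A k t"
  \<comment> \<open>\<open>?f p\<close> is the share of \<open>t\<close> in the summand of
    \<open>p\<close>.\<close>
  let ?f = "\<lambda>p. of_int (sign p) * (if p k = k then t * (\<Prod>i\<in>E - {k}. A $ i $ p i) else 0)"
  have fin: "finite {p. p permutes E}"
    by (simp add: finite_permutations)
  have pr: "(\<Prod>i\<in>E. ?B $ i $ p i)
      = (\<Prod>i\<in>E. A $ i $ p i) + (if p k = k then t * (\<Prod>i\<in>E - {k}. A $ i $ p i) else 0)" for p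
  proof -
    have "(\<Prod>i\<in>E. ?B $ i $ p i) = ?B $ k $ p k * (\<Prod>i\<in>E - {k}. ?B $ i $ p i)"
      using assms by (simp add: prod.remove)
    also have "(\<Prod>i\<in>E - {k}. ?B $ i $ p i) = (\<Prod>i\<in>E - {k}. A $ i $ p i)"
      by (rule prod.cong) (auto simp: add_diagonal_entry_def)
    also have "?B $ k $ p k = A $ k $ p k + (if p k = k then t else 0)"
      by (simp add: add_diagonal_entry_def)
    also have "(\<Prod>i\<in>E. A $ i $ p i) = A $ k $ p k * (\<Prod>i\<in>E - {k}. A $ i $ p i)"
      using assms by (simp add: prod.remove)
    ultimately show ?thesis
      using assms by (simp add: prod.remove[of E k] algebra_simps)
  qed
  have "(\<Sum>p | p permutes E. ?f p) = (\<Sum>p | p permutes E - {k}. ?f p)"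
  proof (rule sum.mono_neutral_right[OF fin])
    show "{p. p permutes E - {k}} \<subseteq> {p. p permutes E}"
      by (auto intro: permutes_subset)
    show "\<forall>p\<in>{p. p permutes E} - {p. p permutes E - {k}}. ?f p = 0"
    proof
      fix p assume p: "p \<in> {p. p permutes E} - {p. p permutes E - {k}}"
      then have "p k \<noteq> k"
        using permutes_superset[of p E "E - {k}"] by auto
      then show "?f p = 0" by simp
    qed
  qed
  also have "\<dots> = (\<Sum>p | p permutes E - {k}. t * (of_int (sign p) * (\<Prod>i\<in>E - {k}. A $ i $ p i)))"
    by (rule sum.cong) (auto dest: permutes_not_in[where x = k])
  finally have "(\<Sum>p | p permutes E. ?f p) = t * principal_minor A (E - {k})"
    by (simp add: principal_minor_def sum_distrib_left)
  then show ?thesis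
    unfolding principal_minor_def[of ?B] principal_minor_def[of A E] pr
    by (simp add: distrib_left sum.distrib)
qed

text \<open>Covers the empty minor as well, which arises as \<open>E - {k}\<close> when
  \<open>E\<close> is \<open>{k}\<close>.\<close>

lemma principal_minor_pos: "P_matrix A \<Longrightarrow> principal_minor A E > 0"
  by (cases "E = {}") (auto simp: P_matrix_def)

lemma P_matrix_add_diagonal_entry:
  assumes "P_matrix A" "t \<ge> 0"
  shows "P_matrix (add_diagonal_entry A k t)"
  unfolding P_matrix_def
proof (intro allI impI)
  fix E
  show "principal_minor (add_diagonal_entry A k t) E > 0"
  proof (cases "k \<in> E")
    case True
    have "t * principal_minor A (E - {k}) \<ge> 0"
      using principal_minor_pos[OF assms(1), of "E - {k}"] assms(2) by simp
    then show ?thesis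
      using principal_minor_pos[OF assms(1), of E]
      by (simp add: principal_minor_add_diagonal_entry True)
  next
    case False
    then show ?thesis
      using principal_minor_pos[OF assms(1)]
      by (simp add: principal_minor_add_diagonal_entry_notin)
  qed
qed

lemma P_matrix_add_diagonal:
  fixes A :: "real^'m^'m"
  assumes "P_matrix A" "\<And>i. d $ i \<ge> 0"
  shows "P_matrix (\<chi> i j. A $ i $ j + (if i = j then d $ i else 0))"
proof -
  \<comment> \<open>The entries are raised one at a time, so that the single-entry lemma drives the
    induction on \<open>K\<close>.\<close>
  have "P_matrix (\<chi> i j. A $ i $ j + (if i = j \<and> i \<in> K then d $ i else 0))" for K :: "'m set"
  proof (induction K rule: finite_induct[OF finite])
    case 1
    then show ?case using assms(1) by (simp add: vec_lambda_eta)
  next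
    case (2 k K)
    have "add_diagonal_entry (\<chi> i j. A $ i $ j + (if i = j \<and> i \<in> K then d $ i else 0)) k (d $ k)
        = (\<chi> i j. A $ i $ j + (if i = j \<and> i \<in> insert k K then d $ i else 0))"
      using 2 by (auto simp: add_diagonal_entry_def vec_eq_iff)
    then show ?case
      using P_matrix_add_diagonal_entry[OF 2(3) assms(2), of k k] by (simp only:)
  qed
  from this[of UNIV] show ?thesis by simp
qed

text \<open>The submatrix on \<open>E\<close> padded by the identity to full size, so that facts on
  determinants and invertibility of full matrices apply to it.\<close>

definition principal_block :: "real^'m^'m \<Rightarrow> 'm set \<Rightarrow> real^'m^'m" where
  "principal_block A E = (\<chi> i j. if i \<in> E \<and> j \<in> E then A $ i $ j else if i = j then 1 else 0)"

text \<open>A permutation moving a point \<open>i\<close> outside \<open>E\<close> picks a zero from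
  row \<open>i\<close>; every other one permutes \<open>E\<close> and picks ones outside it.\<close>

lemma det_principal_block:
  fixes A :: "real^'m^'m"
  shows "det (principal_block A E) = principal_minor A E"
proof -
  let ?g = "\<lambda>p. of_int (sign p) * (\<Prod>i\<in>UNIV. principal_block A E $ i $ p i)"
  have eq: "?g p = of_int (sign p) * (\<Prod>i\<in>E. A $ i $ p i)" if "p permutes E" for p
  proof -
    have "(\<Prod>i\<in>UNIV. principal_block A E $ i $ p i) = (\<Prod>i\<in>E. principal_block A E $ i $ p i)"
      by (rule prod.mono_neutral_right)
        (use that in \<open>auto simp: principal_block_def permutes_not_in\<close>)
    also have "\<dots> = (\<Prod>i\<in>E. A $ i $ p i)"
      by (rule prod.cong) (use that in \<open>auto simp: principal_block_def permutes_in_image\<close>)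
    finally show ?thesis by simp
  qed
  have "det (principal_block A E) = (\<Sum>p | p permutes (UNIV :: 'm set). ?g p)"
    by (simp add: det_def)
  also have "\<dots> = (\<Sum>p | p permutes E. ?g p)"
  proof (rule sum.mono_neutral_right)
    show "finite {p. p permutes (UNIV :: 'm set)}"
      by (simp add: finite_permutations)
    show "{p. p permutes E} \<subseteq> {p. p permutes UNIV}"
      by (auto intro: permutes_subset)
    show "\<forall>p\<in>{p. p permutes UNIV} - {p. p permutes E}. ?g p = 0"
    proof
      fix p assume p: "p \<in> {p. p permutes UNIV} - {p. p permutes E}"
      then obtain i where "i \<notin> E" "p i \<noteq> i"
        by (auto simp: permutes_def)
      then have "principal_block A E $ i $ p i = 0"
        by (auto simp: principal_block_def)
      then show "?g p = 0" by auto
    qed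
  qed
  also have "\<dots> = principal_minor A E"
    unfolding principal_minor_def by (rule sum.cong) (auto simp: eq)
  finally show ?thesis .
qed

text \<open>A vector supported in \<open>E\<close> whose image vanishes on \<open>E\<close> lies in
  the kernel of the padded block.\<close>

lemma principal_submatrix_mult_eq_0:
  fixes A :: "real^'m^'m"
  assumes "principal_minor A E \<noteq> 0" "\<And>i. i \<notin> E \<Longrightarrow> x $ i = 0" "\<And>i. i \<in> E \<Longrightarrow> (A *v x) $ i = 0"
  shows "x = 0"
proof -
  have "(principal_block A E *v x) $ i = 0" for i
  proof (cases "i \<in> E")
    case True
    then have "(principal_block A E *v x) $ i = (A *v x) $ i"
      unfolding matrix_vector_mult_def principal_block_def
      using assms(2) by (auto intro!: sum.cong)
    then show ?thesis using assms(3) True by simp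
  next
    case False
    then have "(principal_block A E *v x) $ i = x $ i"
      by (simp add: matrix_vector_mult_def principal_block_def if_distrib[of "\<lambda>c. c * _"]
          cong: if_cong)
    then show ?thesis using assms(2) False by simp
  qed
  then have "principal_block A E *v x = 0" by (simp add: vec_eq_iff)
  moreover have "invertible (principal_block A E)"
    using assms(1) by (simp add: invertible_det_nz det_principal_block)
  ultimately show ?thesis
    by (metis invertible_def matrix_vector_mul_assoc matrix_vector_mul_lid matrix_vector_mult_0_right)
qed

text \<open>The inverse of the padded block satisfies both equations in
  \<open>principal_inv\<close>, so the choice made there has a witness.\<close>

lemma principal_inv_right:
  fixes A :: "real^'m^'m"
  assumes "principal_minor A E \<noteq> 0" "i \<in> E" "j \<in> E"
  shows "(\<Sum>k\<in>E. A $ i $ k * principal_inv A E $ k $ j) = (if i = j then 1 else 0)"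
proof -
  have "invertible (principal_block A E)"
    using assms(1) by (simp add: invertible_det_nz det_principal_block)
  then obtain B where B: "principal_block A E ** B = mat 1" "B ** principal_block A E = mat 1"
    unfolding invertible_def by blast
  have "(\<Sum>k\<in>E. A $ i $ k * B $ k $ j) = (principal_block A E ** B) $ i $ j" if "i \<in> E" for i j
    unfolding matrix_matrix_mult_def vec_lambda_beta
    by (rule sum.mono_neutral_cong_left) (use that in \<open>auto simp: principal_block_def\<close>)
  moreover have "(\<Sum>k\<in>E. B $ i $ k * A $ k $ j) = (B ** principal_block A E) $ i $ j"
    if "j \<in> E" for i j
    unfolding matrix_matrix_mult_def vec_lambda_beta
    by (rule sum.mono_neutral_cong_left) (use that in \<open>auto simp: principal_block_def\<close>)
  ultimately have "\<exists>B. (\<forall>i\<in>E. \<forall>j\<in>E. (\<Sum>k\<in>E. A $ i $ k * B $ k $ j) = (if i = j then 1 else 0)) \<and>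
     (\<forall>i\<in>E. \<forall>j\<in>E. (\<Sum>k\<in>E. B $ i $ k * A $ k $ j) = (if i = j then 1 else 0))"
    by (intro exI[of _ B]) (simp add: B mat_def)
  from someI_ex[OF this] show ?thesis
    using assms(2,3) unfolding principal_inv_def by blast
qed

text \<open>If all products were nonpositive, a nonnegative diagonal could be added to
  \<open>A\<close> so that the sum sends \<open>x\<close> to zero on the support of
  \<open>x\<close>. The sum is still a P-matrix, so its minor on that support is nonzero, which
  forces \<open>x = 0\<close>.\<close>

lemma P_matrix_sign_nonreversing:
  fixes A :: "real^'m^'m"
  assumes "P_matrix A"
  shows "sign_nonreversing A"
  unfolding sign_nonreversing_def
proof (intro allI impI, rule ccontr)
  fix x :: "real^'m" assume x: "x \<noteq> 0" and "\<nexists>i. x $ i * (A *v x) $ i > 0"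
  then have neg: "x $ i * (A *v x) $ i \<le> 0" for i
    by (meson not_le)
  \<comment> \<open>Chosen to cancel \<open>(A *v x) $ i\<close> where \<open>x $ i\<close> is
    nonzero; elsewhere division by zero yields 0, so \<open>d\<close> is nonnegative
    everywhere.\<close>
  define d :: "real^'m" where "d = (\<chi> i. - (A *v x) $ i / x $ i)"
  have d: "d $ i \<ge> 0" for i
    using neg[of i] by (auto simp: d_def divide_le_0_iff mult_le_0_iff)
  let ?B = "\<chi> i j. A $ i $ j + (if i = j then d $ i else 0)"
  have "(?B *v x) $ i = (A *v x) $ i + d $ i * x $ i" for i
    by (simp add: matrix_vector_mult_def distrib_right sum.distrib if_distrib[of "\<lambda>c. c * _"]
        cong: if_cong)
  then have "(?B *v x) $ i = 0" if "x $ i \<noteq> 0" for i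
    using that by (simp add: d_def)
  moreover have "principal_minor ?B {i. x $ i \<noteq> 0} > 0"
    using P_matrix_add_diagonal[OF assms d] by (rule principal_minor_pos)
  ultimately have "x = 0"
    by (intro principal_submatrix_mult_eq_0[of ?B "{i. x $ i \<noteq> 0}"]) auto
  with x show False by contradiction
qed

section \<open>Z-matrices and inverse positivity\<close>

lemma Z_matrix_off_diagonal_mult_nonpos:
  assumes "Z_matrix A" "x $ i = 0" "\<And>j. x $ j \<ge> 0"
  shows "(A *v x) $ i \<le> 0"
  unfolding matrix_vector_mult_def vec_lambda_beta
proof (rule sum_nonpos)
  fix j
  show "A $ i $ j * x $ j \<le> 0"
    using assms by (cases "j = i") (auto simp: Z_matrix_def mult_le_0_iff)
qed

text \<open>The sign condition is imposed only where \<open>x\<close> is negative, so that the lemma applies to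
  principal submatrices as well.\<close>

lemma Z_matrix_inverse_positive:
  fixes A :: "real^'m^'m"
  assumes "sign_nonreversing A" "Z_matrix A" and x: "\<And>i. x $ i < 0 \<Longrightarrow> (A *v x) $ i \<ge> 0"
  shows "x $ i \<ge> 0"
proof -
  define u v :: "real^'m" where "u = (\<chi> i. max (x $ i) 0)" and "v = (\<chi> i. max (- x $ i) 0)"
  have "x = u - v"
    by (auto simp: u_def v_def vec_eq_iff)
  then have Ax: "A *v x = A *v u - A *v v"
    by (simp add: matrix_vector_mult_diff_distrib)
  \<comment> \<open>Where the negative part \<open>v\<close> is positive, \<open>u\<close> is zero,
    so \<open>(A *v u) $ i\<close> is nonpositive by the Z-property; the hypothesis on
    \<open>A *v x\<close> then passes this sign on to \<open>A *v v\<close>.\<close>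
  have "v $ i * (A *v v) $ i \<le> 0" for i
  proof (cases "x $ i < 0")
    case True
    have "(A *v u) $ i \<le> 0"
      using True by (intro Z_matrix_off_diagonal_mult_nonpos[OF assms(2)]) (auto simp: u_def)
    with x[OF True] have "(A *v v) $ i \<le> 0" by (simp add: Ax)
    then show ?thesis
      by (simp add: mult_le_0_iff v_def)
  qed (simp add: v_def)
  then have "v = 0"
    by (rule sign_nonreversingD[OF assms(1)])
  then have "max (- x $ i) 0 = 0"
    unfolding v_def by (metis vec_lambda_beta zero_index)
  then show ?thesis by linarith
qed

section \<open>Payoffs of the affine game\<close>

text \<open>The \<open>z\<close> of the complementarity problem, extended by zero off
  \<open>E\<close> so that the vectors of different exercise sets can be subtracted.\<close>

definition exercise_multipliers ::
    "real^'m \<Rightarrow> real^'m \<Rightarrow> real^'m^'m \<Rightarrow> 'm set \<Rightarrow> real^'m" where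
  "exercise_multipliers X P G E =
    (\<chi> j. if j \<in> E then \<Sum>k\<in>E. principal_inv G E $ j $ k * (X $ k - P $ k) else 0)"

definition exercise_payoff ::
    "real^'m \<Rightarrow> real^'m \<Rightarrow> real^'m^'m \<Rightarrow> 'm set \<Rightarrow> real^'m" where
  "exercise_payoff X P G E = P + G *v exercise_multipliers X P G E"

lemma affine_game_eq: "affine_game X P G s = exercise_payoff X P G (exercise_set s)"
proof -
  have "(\<Sum>j\<in>E. G $ i $ j * (\<Sum>k\<in>E. principal_inv G E $ j $ k * (X $ k - P $ k)))
      = (G *v exercise_multipliers X P G E) $ i" for i E
    unfolding matrix_vector_mult_def exercise_multipliers_def vec_lambda_beta
    by (rule sum.mono_neutral_cong_left) auto
  then show ?thesis
    by (simp add: affine_game_def exercise_payoff_def Let_def vec_eq_iff)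
qed

lemma exercise_multipliers_notin: "i \<notin> E \<Longrightarrow> exercise_multipliers X P G E $ i = 0"
  by (simp add: exercise_multipliers_def)

lemma exercise_payoff_in:
  fixes G :: "real^'m^'m"
  assumes "P_matrix G" "i \<in> E"
  shows "exercise_payoff X P G E $ i = X $ i"
proof -
  let ?B = "principal_inv G E"
  have nz: "principal_minor G E \<noteq> 0"
    using principal_minor_pos[OF assms(1), of E] by simp
  have "(G *v exercise_multipliers X P G E) $ i
      = (\<Sum>j\<in>E. G $ i $ j * (\<Sum>k\<in>E. ?B $ j $ k * (X $ k - P $ k)))"
    unfolding matrix_vector_mult_def exercise_multipliers_def vec_lambda_beta
    by (rule sum.mono_neutral_cong_right) auto
  also have "\<dots> = (\<Sum>k\<in>E. (\<Sum>j\<in>E. G $ i $ j * ?B $ j $ k) * (X $ k - P $ k))"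
    unfolding sum_distrib_left sum_distrib_right
    by (subst sum.swap) (simp add: mult.assoc)
  also have "\<dots> = (\<Sum>k\<in>E. if i = k then X $ k - P $ k else 0)"
    by (rule sum.cong) (auto simp: principal_inv_right[OF nz assms(2)])
  also have "\<dots> = X $ i - P $ i"
    using assms(2) by simp
  finally show ?thesis by (simp add: exercise_payoff_def)
qed

lemma exercise_payoff_diff:
  "exercise_payoff X P G E - exercise_payoff X P G F
    = G *v (exercise_multipliers X P G E - exercise_multipliers X P G F)"
  by (simp add: exercise_payoff_def matrix_vector_mult_diff_distrib)

section \<open>From strategy profiles to exercise sets\<close>

lemma exercise_set_upd:
  "exercise_set (s(k := Exercise)) = insert k (exercise_set s)"
  "exercise_set (s(k := Not_Exercise)) = exercise_set s - {k}"
  by (auto simp: exercise_set_def)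

lemma UNIV_strategy: "UNIV = {Exercise, Not_Exercise}"
  using strategy.exhaust by auto

instance strategy :: finite
  by standard (simp add: UNIV_strategy)

lemma SUP_strategy: "(SUP a. f a :: real) = max (f Exercise) (f Not_Exercise)"
  by (simp add: UNIV_strategy cSup_eq_Max)

text \<open>The difference \<open>d\<close> lives on \<open>insert k E\<close> and
  \<open>G *v d\<close> vanishes on \<open>E\<close>, so only at \<open>k\<close> can their product
  be positive. Hence the sign of the multiplier of \<open>k\<close> tells whether exercising pays
  for \<open>k\<close>.\<close>

lemma exercise_payoff_insert_sign:
  fixes G :: "real^'m^'m"
  assumes "P_matrix G" "k \<notin> E"
  shows "sgn (X $ k - exercise_payoff X P G E $ k)
    = sgn (exercise_multipliers X P G (insert k E) $ k)"
proof -
  define d where "d = exercise_multipliers X P G (insert k E) - exercise_multipliers X P G E"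
  have Gd: "G *v d = exercise_payoff X P G (insert k E) - exercise_payoff X P G E"
    by (simp add: d_def exercise_payoff_diff)
  have dk: "d $ k = exercise_multipliers X P G (insert k E) $ k"
    using assms(2) by (simp add: d_def exercise_multipliers_notin)
  have Gdk: "(G *v d) $ k = X $ k - exercise_payoff X P G E $ k"
    by (simp add: Gd exercise_payoff_in[OF assms(1)])
  show ?thesis
  proof (cases "d = 0")
    case True
    then show ?thesis using dk Gdk by simp
  next
    case False
    with P_matrix_sign_nonreversing[OF assms(1)] obtain i where i: "d $ i * (G *v d) $ i > 0"
      unfolding sign_nonreversing_def by blast
    have "i = k"
    proof (rule ccontr)
      assume "i \<noteq> k"
      then have "d $ i = 0 \<or> (G *v d) $ i = 0"
        by (cases "i \<in> E")
          (auto simp: d_def[THEN arg_cong[where f = "\<lambda>x. x $ i"]] Gd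
            exercise_multipliers_notin exercise_payoff_in[OF assms(1)])
      with i show False by auto
    qed
    with i show ?thesis
      unfolding dk[symmetric] Gdk[symmetric] by (auto simp: zero_less_mult_iff)
  qed
qed

text \<open>Orthogonality is implicit: the multipliers vanish off \<open>E\<close> and, for a
  P-matrix, the payoff equals \<open>X\<close> on \<open>E\<close>.\<close>

definition complementary :: "real^'m \<Rightarrow> real^'m \<Rightarrow> real^'m^'m \<Rightarrow> 'm set \<Rightarrow> bool" where
  "complementary X P G E \<longleftrightarrow>
    (\<forall>i. exercise_multipliers X P G E $ i \<ge> 0 \<and> exercise_payoff X P G E $ i \<ge> X $ i)"

text \<open>A player in the exercise set gets \<open>X $ k\<close>, and the sign lemma at
  \<open>?E - {k}\<close> turns the test against leaving into a sign condition on the multiplier. A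
  player outside has multiplier 0 and would get \<open>X $ k\<close> by exercising.\<close>

lemma nash_equilibrium_iff_complementary:
  fixes G :: "real^'m^'m"
  assumes "P_matrix G"
  shows "nash_equilibrium (affine_game X P G) \<sigma> \<longleftrightarrow> complementary X P G (exercise_set \<sigma>)"
proof -
  let ?E = "exercise_set \<sigma>" and ?z = "exercise_multipliers X P G" and ?V = "exercise_payoff X P G"
  have iff: "?V ?E $ k = max (?V (insert k ?E) $ k) (?V (?E - {k}) $ k)
      \<longleftrightarrow> ?z ?E $ k \<ge> 0 \<and> ?V ?E $ k \<ge> X $ k" for k
  proof (cases "k \<in> ?E")
    case True
    then have ins: "insert k ?E = ?E" "insert k (?E - {k}) = ?E" by auto
    have "sgn (X $ k - ?V (?E - {k}) $ k) = sgn (?z ?E $ k)"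
      using exercise_payoff_insert_sign[OF assms, of k "?E - {k}" X P] unfolding ins by simp
    then have "?z ?E $ k \<ge> 0 \<longleftrightarrow> ?V (?E - {k}) $ k \<le> X $ k"
      unfolding sgn_if by (simp split: if_splits)
    then show ?thesis
      unfolding ins exercise_payoff_in[OF assms True] by linarith
  next
    case False
    then have diff: "?E - {k} = ?E" by simp
    have "?V (insert k ?E) $ k = X $ k" by (simp add: exercise_payoff_in[OF assms])
    then show ?thesis
      unfolding diff exercise_multipliers_notin[OF False] max_def by auto
  qed
  show ?thesis
    unfolding nash_equilibrium_def complementary_def affine_game_eq SUP_strategy exercise_set_upd iff ..
qed

text \<open>By complementarity each product of multiplier difference and payoff difference is minus
  a sum of products of nonnegative numbers, so sign non-reversal makes the multipliers
  agree.\<close>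

lemma complementary_payoff_unique:
  fixes G :: "real^'m^'m"
  assumes "P_matrix G" "complementary X P G E" "complementary X P G F"
  shows "exercise_payoff X P G E = exercise_payoff X P G F"
proof -
  let ?z = "exercise_multipliers X P G" and ?V = "exercise_payoff X P G"
  have "(?z E - ?z F) $ i * (G *v (?z E - ?z F)) $ i \<le> 0" for i
    using assms(2,3)[unfolded complementary_def, rule_format, of i]
    unfolding exercise_payoff_diff[symmetric]
    by (cases "i \<in> E"; cases "i \<in> F")
      (auto simp: exercise_multipliers_notin exercise_payoff_in[OF assms(1)] mult_le_0_iff)
  then have "?z E - ?z F = 0"
    by (rule sign_nonreversingD[OF P_matrix_sign_nonreversing[OF assms(1)]])
  then show ?thesis
    by (simp add: exercise_payoff_def)
qed

lemma complementary_exists: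
  fixes G :: "real^'m^'m"
  assumes "P_matrix G"
  shows "\<exists>E. complementary X P G E"
proof -
  let ?z = "exercise_multipliers X P G" and ?V = "exercise_payoff X P G"
  \<comment> \<open>The strict inequality breaks ties: an indifferent player is content only when exercising.\<close>
  define content where "content E = {i. if i \<in> E then ?z E $ i \<ge> 0 else ?V E $ i > X $ i}" for E
  have "inj content"
  proof (rule injI, rule ccontr)
    fix E F assume eq: "content E = content F" and "E \<noteq> F"
    have iff: "(if i \<in> E then ?z E $ i \<ge> 0 else ?V E $ i > X $ i)
        \<longleftrightarrow> (if i \<in> F then ?z F $ i \<ge> 0 else ?V F $ i > X $ i)" for i
      using eq unfolding content_def by blast
    let ?d = "?z E - ?z F"
    show False
    proof (cases "?d = 0")
      case True
      then have "?z E = ?z F" "?V E = ?V F"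
        by (simp_all add: exercise_payoff_def)
      moreover from \<open>E \<noteq> F\<close> obtain i where "i \<in> E \<longleftrightarrow> i \<notin> F" by blast
      \<comment> \<open>A player in exactly one of the sets now has multiplier 0 and payoff
        \<open>X $ i\<close>; the tie-breaking makes that player content in one set and not in the
        other.\<close>
      ultimately show False
        using iff[of i] exercise_payoff_in[OF assms, of i E X P] exercise_payoff_in[OF assms, of i F X P]
          exercise_multipliers_notin[of i E X P G] exercise_multipliers_notin[of i F X P G]
        by (auto split: if_splits)
    next
      case False
      with P_matrix_sign_nonreversing[OF assms] obtain i where "?d $ i * (G *v ?d) $ i > 0"
        unfolding sign_nonreversing_def by blast
      then have "(?z E $ i - ?z F $ i) * (?V E $ i - ?V F $ i) > 0"
        by (simp add: exercise_payoff_diff[symmetric])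
      \<comment> \<open>A positive product excludes that \<open>i\<close> lies in both sets or in
        neither. In the remaining cases it makes \<open>i\<close> content with exactly one of them,
        against \<open>iff\<close>.\<close>
      then show False
        using iff[of i]
        by (cases "i \<in> E"; cases "i \<in> F")
          (auto simp: exercise_multipliers_notin exercise_payoff_in[OF assms] zero_less_mult_iff
            mult_less_0_iff)
    qed
  qed
  then have "surj content"
    by (simp add: finite_UNIV_inj_surj)
  then obtain E where "content E = UNIV"
    by (metis surjD)
  then have "if i \<in> E then ?z E $ i \<ge> 0 else ?V E $ i > X $ i" for i
    unfolding content_def by blast
  then have "?z E $ i \<ge> 0 \<and> ?V E $ i \<ge> X $ i" for i
    using exercise_multipliers_notin[of i E X P G] exercise_payoff_in[OF assms, of i E X P]
    by (metis less_imp_le order_refl)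
  then have "complementary X P G E"
    by (simp add: complementary_def)
  then show ?thesis ..
qed

section \<open>The variational inequality\<close>

lemma P_matrix_invertible: "P_matrix G \<Longrightarrow> invertible G"
  using principal_minor_pos[of G UNIV] by (simp add: principal_minor_UNIV invertible_det_nz)

lemma matrix_inv_right_left:
  fixes A :: "real^'m^'m"
  assumes "invertible A"
  shows "A ** matrix_inv A = mat 1" "matrix_inv A ** A = mat 1"
  using someI_ex[OF assms[unfolded invertible_def]] unfolding matrix_inv_def by blast+

lemma matrix_inv_mult_cancel:
  fixes A :: "real^'m^'m"
  assumes "invertible A"
  shows "matrix_inv A *v (A *v x) = x" "A *v (matrix_inv A *v x) = x"
  by (simp_all add: matrix_vector_mul_assoc matrix_inv_right_left[OF assms])

text \<open>Applying the inverse of \<open>G\<close> recovers the multipliers, and the inner product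
  is nonnegative term by term: off \<open>E\<close> the multiplier is 0, on \<open>E\<close> the
  payoff is \<open>X $ i\<close>, at most \<open>y $ i\<close>.\<close>

lemma complementary_variational_inequality:
  fixes G :: "real^'m^'m"
  assumes "P_matrix G" "complementary X P G E" "y \<in> upper_orthant X"
  shows "(matrix_inv G *v (exercise_payoff X P G E - P)) \<bullet> (y - exercise_payoff X P G E) \<ge> 0"
proof -
  let ?z = "exercise_multipliers X P G E" and ?V = "exercise_payoff X P G E"
  have "matrix_inv G *v (?V - P) = ?z"
    by (simp add: exercise_payoff_def matrix_inv_mult_cancel P_matrix_invertible assms(1))
  moreover have "?z $ i * (y $ i - ?V $ i) \<ge> 0" for i
    using assms(2,3)
    by (cases "i \<in> E")
      (auto simp: exercise_multipliers_notin exercise_payoff_in[OF assms(1)] complementary_def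
        upper_orthant_def)
  ultimately show ?thesis
    by (simp add: inner_vec_def sum_nonneg)
qed

section \<open>Projection in a weighted inner product\<close>

lemma symmetric_positive_definite_inv:
  fixes A :: "real^'m^'m"
  assumes "symmetric_positive_definite A" "invertible A"
  shows "symmetric_positive_definite (matrix_inv A)"
  unfolding symmetric_positive_definite_def
proof (intro conjI allI impI)
  let ?B = "matrix_inv A"
  have sym: "transpose A = A" using assms(1) by (simp add: symmetric_positive_definite_def)
  have "transpose ?B ** A = mat 1"
    by (metis matrix_transpose_mul sym matrix_inv_right_left(1)[OF assms(2)] transpose_mat)
  then show "transpose ?B = ?B"
    by (metis matrix_mul_assoc matrix_mul_lid matrix_mul_rid matrix_inv_right_left(1)[OF assms(2)])
  fix x :: "real^'m" assume "x \<noteq> 0"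
  then have "?B *v x \<noteq> 0"
    using matrix_inv_mult_cancel(2)[OF assms(2), of x] by auto
  then have "(?B *v x) \<bullet> (A *v (?B *v x)) > 0"
    using assms(1) unfolding symmetric_positive_definite_def by blast
  then show "x \<bullet> (?B *v x) > 0"
    by (simp add: matrix_inv_mult_cancel(2)[OF assms(2)] inner_commute)
qed

lemma inner_wrt_commute:
  assumes "symmetric_positive_definite A"
  shows "inner_wrt A x y = inner_wrt A y x"
  using assms unfolding inner_wrt_def symmetric_positive_definite_def
  by (metis dot_lmul_matrix inner_commute vector_transpose_matrix)

text \<open>Expanding the squared distance from \<open>p\<close> around \<open>z\<close> leaves a
  cross term that \<open>vi\<close> makes nonnegative. So \<open>z\<close> is nearest, and any other
  nearest point is at distance 0 from \<open>z\<close>.\<close>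

lemma projection_wrt_eqI:
  fixes A :: "real^'m^'m"
  assumes A: "symmetric_positive_definite A" and z: "z \<in> K"
    and vi: "\<And>y. y \<in> K \<Longrightarrow> (A *v (z - p)) \<bullet> (y - z) \<ge> 0"
  shows "projection_wrt A K p = z"
proof -
  have expand: "inner_wrt A (p - y) (p - y)
      = inner_wrt A (p - z) (p - z) + inner_wrt A (y - z) (y - z)
        + 2 * ((A *v (z - p)) \<bullet> (y - z))" for y
  proof -
    define a b where "a = z - p" and "b = y - z"
    have minus: "inner_wrt A (- x) (- x) = inner_wrt A x x" for x
      by (simp add: inner_wrt_def vec.neg)
    have "p - y = - (a + b)" "p - z = - a" by (simp_all add: a_def b_def)
    moreover have "inner_wrt A (a + b) (a + b)
        = inner_wrt A a a + inner_wrt A b b + inner_wrt A a b + inner_wrt A b a"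
      by (simp add: inner_wrt_def matrix_vector_right_distrib inner_add_left inner_add_right)
    moreover have "inner_wrt A a b = (A *v a) \<bullet> b" "inner_wrt A b a = (A *v a) \<bullet> b"
      using inner_wrt_commute[OF A, of a b] by (simp_all add: inner_wrt_def inner_commute)
    ultimately show ?thesis
      using minus[of "a + b"] minus[of a] by (simp flip: a_def b_def)
  qed
  have pos: "inner_wrt A x x > 0" if "x \<noteq> 0" for x
    using A that by (simp add: symmetric_positive_definite_def inner_wrt_def)
  show ?thesis
    unfolding projection_wrt_def norm_wrt_def real_sqrt_le_iff
  proof (rule the_equality)
    have "inner_wrt A (p - z) (p - z) \<le> inner_wrt A (p - y) (p - y)" if "y \<in> K" for y
    proof -
      have "inner_wrt A (y - z) (y - z) \<ge> 0"
        using pos[of "y - z"] by (cases "y = z") (auto simp: inner_wrt_def)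
      then show ?thesis using expand[of y] vi[OF that] by linarith
    qed
    with z show "z \<in> K \<and> (\<forall>y\<in>K. inner_wrt A (p - z) (p - z) \<le> inner_wrt A (p - y) (p - y))"
      by blast
  next
    fix y assume y: "y \<in> K \<and> (\<forall>w\<in>K. inner_wrt A (p - y) (p - y) \<le> inner_wrt A (p - w) (p - w))"
    then have "inner_wrt A (y - z) (y - z) \<le> 0"
      using expand[of y] vi[of y] z by fastforce
    then show "y = z"
      using pos[of "y - z"] by fastforce
  qed
qed

section \<open>K-matrices: competitiveness and value\<close>

text \<open>When \<open>k\<close> joins the exercise set, the payoffs on \<open>E\<close> stay
  fixed. If \<open>k\<close> does not lose, inverse positivity on \<open>insert k E\<close> makes
  the multipliers grow, and by the Z-property this lowers, or keeps, the payoffs outside.\<close>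

lemma K_matrix_insert_payoff:
  fixes X P :: "real^'m" and G :: "real^'m^'m"
  assumes "K_matrix G" "k \<notin> E" "l \<noteq> k"
  defines "V \<equiv> exercise_payoff X P G"
  shows "V E $ k < V (insert k E) $ k \<Longrightarrow> V (insert k E) $ l \<le> V E $ l"
    and "V (insert k E) $ k < V E $ k \<Longrightarrow> V E $ l \<le> V (insert k E) $ l"
    and "V E $ k = V (insert k E) $ k \<Longrightarrow> V E $ l = V (insert k E) $ l"
proof -
  have G: "P_matrix G" "Z_matrix G" using assms(1) by (auto simp: K_matrix_def)
  note nonrev = P_matrix_sign_nonreversing[OF G(1)]
  define d where "d = exercise_multipliers X P G (insert k E) - exercise_multipliers X P G E"
  have Gd: "G *v d = V (insert k E) - V E"
    by (simp add: d_def V_def exercise_payoff_diff)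
  have off: "d $ i = 0" if "i \<notin> insert k E" for i
    using that by (simp add: d_def exercise_multipliers_notin)
  have on: "(G *v d) $ i = 0" if "i \<in> E" for i
    using that by (simp add: Gd V_def exercise_payoff_in[OF G(1)])
  \<comment> \<open>Stated for a general \<open>x\<close> because it serves both \<open>d\<close>
    and \<open>- d\<close>.\<close>
  have nonpos: "(G *v x) $ l \<le> 0"
    if x: "\<And>i. i \<notin> insert k E \<Longrightarrow> x $ i = 0" "\<And>i. i \<in> E \<Longrightarrow> (G *v x) $ i = 0" "(G *v x) $ k \<ge> 0"
    for x
  proof -
    have "(G *v x) $ i \<ge> 0" if "x $ i < 0" for i
      using x(1)[of i] x(2)[of i] x(3) that by (cases "i = k"; cases "i \<in> E") auto
    then have "x $ i \<ge> 0" for i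
      by (rule Z_matrix_inverse_positive[OF nonrev G(2)])
    then show ?thesis
      using x(1,2) assms(3) Z_matrix_off_diagonal_mult_nonpos[OF G(2), of x l] by (cases "l \<in> E") auto
  qed
  have neg: "G *v (- d) = - (G *v d)"
    by (simp add: vec.neg)
  have le: "V (insert k E) $ l \<le> V E $ l" if "V E $ k \<le> V (insert k E) $ k"
    using nonpos[of d] off on that Gd by auto
  have ge: "V E $ l \<le> V (insert k E) $ l" if "V (insert k E) $ k \<le> V E $ k"
    using nonpos[of "- d"] off on that neg Gd by auto
  show "V E $ k < V (insert k E) $ k \<Longrightarrow> V (insert k E) $ l \<le> V E $ l"
    and "V (insert k E) $ k < V E $ k \<Longrightarrow> V E $ l \<le> V (insert k E) $ l"
    and "V E $ k = V (insert k E) $ k \<Longrightarrow> V E $ l = V (insert k E) $ l"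
    using le ge by auto
qed

lemma K_matrix_WUC:
  fixes G :: "real^'m^'m"
  assumes "K_matrix G"
  shows "weakly_unilaterally_competitive (affine_game X P G)"
  unfolding weakly_unilaterally_competitive_def
proof (intro allI impI)
  fix k l :: 'm and a b and s :: "'m profile"
  assume "k \<noteq> l"
  define F where "F = exercise_set s - {k}"
  have set: "exercise_set (s(k := Exercise)) = insert k F" "exercise_set (s(k := Not_Exercise)) = F"
    by (simp_all add: F_def exercise_set_upd)
  have notin: "k \<notin> F" by (simp add: F_def)
  note K = K_matrix_insert_payoff[OF assms notin \<open>k \<noteq> l\<close>[symmetric], of X P]
  consider "a = b" | "a = Exercise" "b = Not_Exercise" | "a = Not_Exercise" "b = Exercise"
    by (cases a; cases b) auto
  then show "(affine_game X P G (s(k := b)) $ k < affine_game X P G (s(k := a)) $ k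
        \<longrightarrow> affine_game X P G (s(k := a)) $ l \<le> affine_game X P G (s(k := b)) $ l)
      \<and> (affine_game X P G (s(k := a)) $ k = affine_game X P G (s(k := b)) $ k
        \<longrightarrow> affine_game X P G (s(k := a)) $ l = affine_game X P G (s(k := b)) $ l)"
  proof cases
    case 1
    then show ?thesis by simp
  next
    case 2
    show ?thesis
      unfolding affine_game_eq 2 set by (intro conjI impI K(1) K(3)[symmetric]; (assumption | erule sym))
  next
    case 3
    show ?thesis
      unfolding affine_game_eq 3 set by (intro conjI impI K(2) K(3))
  qed
qed

text \<open>Keeping the equilibrium strategy guarantees the equilibrium payoff. Where
  \<open>d\<close> is negative, \<open>F\<close> exercises and pays \<open>X\<close>, at most the
  payoff of \<open>E\<close>; so \<open>d\<close> is nonnegative by inverse positivity, and the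
  Z-property settles a \<open>k\<close> outside both sets.\<close>

lemma K_matrix_complementary_payoff_le:
  fixes G :: "real^'m^'m"
  assumes "K_matrix G" "complementary X P G E" "k \<in> E \<longleftrightarrow> k \<in> F"
  shows "exercise_payoff X P G E $ k \<le> exercise_payoff X P G F $ k"
proof -
  let ?z = "exercise_multipliers X P G" and ?V = "exercise_payoff X P G"
  have G: "P_matrix G" "Z_matrix G" using assms(1) by (auto simp: K_matrix_def)
  define d where "d = ?z E - ?z F"
  have Gd: "G *v d = ?V E - ?V F"
    by (simp add: d_def exercise_payoff_diff)
  show ?thesis
  proof (cases "k \<in> E")
    case True
    then show ?thesis using assms(3) by (simp add: exercise_payoff_in[OF G(1)])
  next
    case False
    have "(G *v d) $ i \<ge> 0" if "d $ i < 0" for i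
    proof -
      have "?z E $ i \<ge> 0"
        using assms(2) by (simp add: complementary_def)
      with that have "?z F $ i \<noteq> 0"
        by (simp add: d_def)
      then have "i \<in> F"
        using exercise_multipliers_notin[of i F X P G] by blast
      then have "?V F $ i = X $ i"
        by (rule exercise_payoff_in[OF G(1)])
      then show ?thesis
        using assms(2) by (simp add: Gd complementary_def)
    qed
    then have "d $ i \<ge> 0" for i
      by (rule Z_matrix_inverse_positive[OF P_matrix_sign_nonreversing[OF G(1)] G(2)])
    moreover have "d $ k = 0"
      using False assms(3) by (simp add: d_def exercise_multipliers_notin)
    ultimately have "(G *v d) $ k \<le> 0"
      by (rule Z_matrix_off_diagonal_mult_nonpos[OF G(2), rotated])
    then show ?thesis by (simp add: Gd)
  qed
qed

text \<open>The guarantee \<open>min\<close> puts the payoff below the maximin, the Nash property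
  puts it above the minimax, and the maximin never exceeds the minimax.\<close>

lemma nash_payoff_is_game_value:
  fixes V :: "'m profile \<Rightarrow> real^'m"
  assumes nash: "nash_equilibrium V \<sigma>"
    and min: "\<And>k s. V \<sigma> $ k \<le> V (s(k := \<sigma> k)) $ k"
  shows "is_game_value V (V \<sigma>)"
  unfolding is_game_value_def
proof
  fix k
  \<comment> \<open>Strategies and profiles form finite types, so every infimum and supremum here is
    over a bounded set.\<close>
  have bdd: "bdd_below (range f)" "bdd_above (range f)" for f :: "'b::finite \<Rightarrow> real"
    by simp_all
  have "V \<sigma> $ k \<le> (INF s. V (s(k := \<sigma> k)) $ k)"
    by (rule cINF_greatest) (use min in auto)
  also have "\<dots> \<le> (SUP a. INF s. V (s(k := a)) $ k)"
    by (rule cSUP_upper) (auto intro: bdd)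
  finally have 1: "V \<sigma> $ k \<le> (SUP a. INF s. V (s(k := a)) $ k)" .
  have "(INF s. V (s(k := a)) $ k) \<le> (SUP a. V (t(k := a)) $ k)" for a t
    by (rule order_trans[OF cINF_lower cSUP_upper]) (auto intro: bdd)
  then have 2: "(SUP a. INF s. V (s(k := a)) $ k) \<le> (INF s. SUP a. V (s(k := a)) $ k)"
    by (intro cSUP_least cINF_greatest) auto
  have "(INF s. SUP a. V (s(k := a)) $ k) \<le> (SUP a. V (\<sigma>(k := a)) $ k)"
    by (rule cINF_lower) (auto intro: bdd)
  also have "\<dots> = V \<sigma> $ k"
    using nash by (simp add: nash_equilibrium_def)
  finally show "V \<sigma> $ k = (SUP a. INF s. V (s(k := a)) $ k) \<and>
     (SUP a. INF s. V (s(k := a)) $ k) = (INF s. SUP a. V (s(k := a)) $ k)"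
    using 1 2 by linarith
qed

lemma is_game_value_unique: "is_game_value V v \<Longrightarrow> is_game_value V w \<Longrightarrow> v = w"
  by (simp add: is_game_value_def vec_eq_iff)

theorem theorem2p1:
  fixes X P :: "real^'m" and G :: "real^'m^'m"
  assumes "P_matrix G"
  shows "\<exists>Vstar :: real^'m.
    (\<exists>\<sigma>. nash_equilibrium (affine_game X P G) \<sigma>) \<and>
    (\<forall>\<sigma>. nash_equilibrium (affine_game X P G) \<sigma> \<longrightarrow> affine_game X P G \<sigma> = Vstar) \<and>
    (\<forall>y\<in>upper_orthant X. (matrix_inv G *v (Vstar - P)) \<bullet> (y - Vstar) \<ge> 0) \<and>
    (symmetric_positive_definite G \<longrightarrow>
      Vstar = projection_wrt (matrix_inv G) (upper_orthant X) P) \<and>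
    (K_matrix G \<longrightarrow>
      weakly_unilaterally_competitive (affine_game X P G) \<and>
      is_game_value (affine_game X P G) Vstar \<and>
      (\<forall>v. is_game_value (affine_game X P G) v \<longrightarrow> v = Vstar))"
proof -
  obtain E where E: "complementary X P G E"
    using complementary_exists[OF assms] by blast
  define \<sigma> where "\<sigma> i = (if i \<in> E then Exercise else Not_Exercise)" for i
  have \<sigma>: "exercise_set \<sigma> = E" by (auto simp: \<sigma>_def exercise_set_def)
  let ?V = "affine_game X P G"
  have V\<sigma>: "?V \<sigma> = exercise_payoff X P G E" by (simp add: affine_game_eq \<sigma>)
  have nash: "nash_equilibrium ?V \<sigma>"
    using E by (simp add: nash_equilibrium_iff_complementary[OF assms] \<sigma>)
  have unique: "?V \<tau> = ?V \<sigma>" if "nash_equilibrium ?V \<tau>" for \<tau>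
    unfolding V\<sigma> affine_game_eq[of _ _ _ \<tau>]
    using that E by (intro complementary_payoff_unique[OF assms])
      (simp_all add: nash_equilibrium_iff_complementary[OF assms])
  have vi: "(matrix_inv G *v (?V \<sigma> - P)) \<bullet> (y - ?V \<sigma>) \<ge> 0" if "y \<in> upper_orthant X" for y
    unfolding V\<sigma> by (rule complementary_variational_inequality[OF assms E that])
  have proj: "projection_wrt (matrix_inv G) (upper_orthant X) P = ?V \<sigma>" if "symmetric_positive_definite G"
    using symmetric_positive_definite_inv[OF that P_matrix_invertible[OF assms]] _ vi
    by (rule projection_wrt_eqI) (use E in \<open>simp add: V\<sigma> complementary_def upper_orthant_def\<close>)
  have val: "is_game_value ?V (?V \<sigma>)" if K: "K_matrix G"
  proof (rule nash_payoff_is_game_value[OF nash])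
    fix k s
    \<comment> \<open>The opponents in \<open>s\<close> are arbitrary; overwriting entry
      \<open>k\<close> makes the two exercise sets agree at \<open>k\<close>.\<close>
    have "k \<in> E \<longleftrightarrow> k \<in> exercise_set (s(k := \<sigma> k))"
      by (simp add: \<sigma>_def exercise_set_def)
    then show "?V \<sigma> $ k \<le> ?V (s(k := \<sigma> k)) $ k"
      unfolding V\<sigma> affine_game_eq[of _ _ _ "s(k := \<sigma> k)"]
      by (rule K_matrix_complementary_payoff_le[OF K E])
  qed
  have val_unique: "v = ?V \<sigma>" if "K_matrix G" "is_game_value ?V v" for v
    using that(2) val[OF that(1)] by (rule is_game_value_unique)
  show ?thesis
  proof (rule exI[of _ "?V \<sigma>"], intro conjI allI ballI impI)
    show "\<exists>\<sigma>. nash_equilibrium ?V \<sigma>" using nash by blast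
  qed (fact unique vi proj[symmetric] K_matrix_WUC val val_unique)+
qed

end
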